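(* Let $X$ be a Hausdorff, locally compact, second countable topological space, $\mathcal{H}$ a Hilbert space, and $F:\mathcal{B}(X)\to\mathcal{L}_s^+(\mathcal{H})$ a POVM. Let $F$ be norm bounded by a finite measure $\nu$ on $\mathcal{B}(X)$. Then $F$ is uniformly continuous.
   Context: $\mathcal{B}(X)$ is the Borel $\sigma$-algebra of $X$; $\mathcal{L}_s^+(\mathcal{H})$ is the set of bounded positive self-adjoint operators on $\mathcal{H}$. A POVM is a map $F:\mathcal{B}(X)\to\mathcal{L}_s^+(\mathcal{H})$ with $F(\bigcup_n\Delta_n)=\sum_nF(\Delta_n)$ for every countable family of pairwise disjoint Borel sets, the series converging in the weak operator topology. $F$ is norm bounded by a measure $\nu$ on $\mathcal{B}(X)$ if there exists a positive number $c$ such that $\|F(\Delta)\|\le c\,\nu(\Delta)$ for each $\Delta\in\mathcal{B}(X)$. $F$ is uniformly continuous if for every $\Delta\in\mathcal{B}(X)$ and every decomposition $\Delta=\bigcup_{i=1}^\infty\Delta_i$ into pairwise disjoint Borel sets, $\lim_{n\to\infty}\sum_{i=1}^nF(\Delta_i)=F(\Delta)$ in the uniform operator (norm) topology. *)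

theory Defs
  imports "HOL-Analysis.Analysis"
begin

section \<open>Complex Hilbert spaces\<close>

text \<open>The inner product is conjugate-linear in its first argument and linear in its second.
  Completeness is part of \<^class>\<open>banach\<close>.\<close>

class complex_hilbert_space = banach +
  fixes scaleC :: "complex \<Rightarrow> 'a \<Rightarrow> 'a"  (infixr "*\<^sub>C" 75)
    and cinner :: "'a \<Rightarrow> 'a \<Rightarrow> complex"
  assumes scaleR_scaleC: "r *\<^sub>R x = complex_of_real r *\<^sub>C x"
    and scaleC_add_right: "a *\<^sub>C (x + y) = a *\<^sub>C x + a *\<^sub>C y"
    and scaleC_add_left: "(a + b) *\<^sub>C x = a *\<^sub>C x + b *\<^sub>C x"
    and scaleC_scaleC: "a *\<^sub>C b *\<^sub>C x = (a * b) *\<^sub>C x"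
    and scaleC_one: "1 *\<^sub>C x = x"
    and cinner_commute: "cinner x y = cnj (cinner y x)"
    and cinner_add_right: "cinner x (y + z) = cinner x y + cinner x z"
    and cinner_scaleC_right: "cinner x (a *\<^sub>C y) = a * cinner x y"
    and cinner_ge_zero: "cinner x x \<in> \<real>\<^sub>\<ge>\<^sub>0"
    and cinner_eq_zero_iff: "cinner x x = 0 \<longleftrightarrow> x = 0"
    and norm_eq_sqrt_cinner: "norm x = sqrt (Re (cinner x x))"

instantiation complex :: complex_hilbert_space
begin
definition scaleC_complex :: "complex \<Rightarrow> complex \<Rightarrow> complex" where "scaleC_complex a x = a * x"
definition cinner_complex :: "complex \<Rightarrow> complex \<Rightarrow> complex" where "cinner_complex x y = cnj x * y"
instance
  by standard
    (auto simp: scaleC_complex_def cinner_complex_def scaleR_conv_of_real algebra_simps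
      complex_nonneg_Reals_iff cmod_def power2_eq_square)
end

section \<open>Bounded positive self-adjoint operators\<close>

text \<open>Elements of \<^typ>\<open>'h \<Rightarrow>\<^sub>L 'h\<close> are only real-linear, so complex linearity is imposed
  separately. The norm of \<^typ>\<open>'h \<Rightarrow>\<^sub>L 'h\<close> is the operator norm.\<close>

definition complex_linear :: "('h::complex_hilbert_space \<Rightarrow>\<^sub>L 'h) \<Rightarrow> bool" where
  "complex_linear A \<longleftrightarrow> (\<forall>a x. A (a *\<^sub>C x) = a *\<^sub>C A x)"

definition selfadjoint :: "('h::complex_hilbert_space \<Rightarrow>\<^sub>L 'h) \<Rightarrow> bool" where
  "selfadjoint A \<longleftrightarrow> (\<forall>x y. cinner (A x) y = cinner x (A y))"

definition positive_operators :: "('h::complex_hilbert_space \<Rightarrow>\<^sub>L 'h) set" where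
  "positive_operators =
    {A. complex_linear A \<and> selfadjoint A \<and> (\<forall>x. cinner x (A x) \<in> \<real>\<^sub>\<ge>\<^sub>0)}"

text \<open>The coarsest topology making all matrix coefficients \<open>A \<mapsto> cinner x (A y)\<close> continuous;
  compare \<^const>\<open>strong_operator_topology\<close>.\<close>

definition weak_operator_topology :: "('h::complex_hilbert_space \<Rightarrow>\<^sub>L 'h) topology" where
  "weak_operator_topology = pullback_topology UNIV (\<lambda>A x y. cinner x (blinfun_apply A y)) euclidean"

lemma limitin_weak_operator_topology:
  "limitin weak_operator_topology A L G \<longleftrightarrow>
    (\<forall>x y. ((\<lambda>n. cinner x (blinfun_apply (A n) y)) \<longlongrightarrow> cinner x (blinfun_apply L y)) G)"
  (is "?l \<longleftrightarrow> ?r")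
proof -
  let ?f = "\<lambda>A x y. cinner x (blinfun_apply A y)"
  have "?l \<longleftrightarrow> ((\<lambda>n. ?f (A n)) \<longlongrightarrow> ?f L) G"
    unfolding limitin_def tendsto_def weak_operator_topology_def
      openin_pullback_topology topspace_pullback_topology by auto
  also have "\<dots> \<longleftrightarrow> ?r"
    unfolding limitin_canonical_iff[symmetric] euclidean_product_topology[symmetric]
      limitin_componentwise by simp
  finally show ?thesis .
qed

section \<open>Positive operator valued measures\<close>

definition povm ::
    "('x::topological_space set \<Rightarrow> ('h::complex_hilbert_space \<Rightarrow>\<^sub>L 'h)) \<Rightarrow> bool" where
  "povm F \<longleftrightarrow>
    (\<forall>\<Delta>\<in>sets borel. F \<Delta> \<in> positive_operators) \<and>
    (\<forall>D :: nat \<Rightarrow> 'x set. range D \<subseteq> sets borel \<longrightarrow> disjoint_family D \<longrightarrow>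
      limitin weak_operator_topology (\<lambda>n. \<Sum>i<n. F (D i)) (F (\<Union>i. D i)) sequentially)"

definition norm_bounded_by ::
    "('x::topological_space set \<Rightarrow> ('h::complex_hilbert_space \<Rightarrow>\<^sub>L 'h)) \<Rightarrow> 'x measure \<Rightarrow> bool" where
  "norm_bounded_by F \<nu> \<longleftrightarrow>
    (\<exists>c::real. c > 0 \<and> (\<forall>\<Delta>\<in>sets borel. ennreal (norm (F \<Delta>)) \<le> ennreal c * emeasure \<nu> \<Delta>))"

text \<open>The limit is taken in the operator norm.\<close>

definition uniformly_continuous_povm ::
    "('x::topological_space set \<Rightarrow> ('h::complex_hilbert_space \<Rightarrow>\<^sub>L 'h)) \<Rightarrow> bool" where
  "uniformly_continuous_povm F \<longleftrightarrow>
    (\<forall>\<Delta>\<in>sets borel. \<forall>D :: nat \<Rightarrow> 'x set.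
      range D \<subseteq> sets borel \<longrightarrow> disjoint_family D \<longrightarrow> \<Delta> = (\<Union>i. D i) \<longrightarrow>
      (\<lambda>n. \<Sum>i<n. F (D i)) \<longlonglongrightarrow> F \<Delta>)"

end

theory Submission
  imports Defs
begin

text \<open>Cut a disjoint union after its first \<open>n\<close> pieces. Weak countable additivity, applied once to
  the whole family and once to the family of remaining pieces, identifies the error
  \<open>F (\<Union>i. D i) - (\<Sum>i<n. F (D i))\<close> with the single operator \<open>F (\<Union>i. D (i + n))\<close>
  (lemma \<open>povm_split_tail\<close>). The point is that this error is itself a value of \<open>F\<close>, so the norm bound
  controls it by \<open>c * \<nu> (\<Union>i. D (i + n))\<close>. These remainders decrease to the empty set because
  the pieces are disjoint, so a finite \<open>\<nu>\<close> sends their measures to zero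
  (lemma \<open>finite_measure_tail_tendsto_0\<close>), and the error vanishes in operator norm.\<close>

lemma cinner_diff_right: "cinner x (y - z) = cinner x y - cinner x z"
  for x :: "'h::complex_hilbert_space"
  using cinner_add_right[of x "y - z" z] by simp

lemma cinner_right_eqI:
  fixes y z :: "'h::complex_hilbert_space"
  assumes "\<And>x. cinner x y = cinner x z"
  shows "y = z"
proof -
  have "cinner (y - z) (y - z) = 0"
    using assms by (simp add: cinner_diff_right)
  then show ?thesis
    by (simp add: cinner_eq_zero_iff)
qed

lemma limitin_weak_operator_topology_unique:
  assumes "limitin weak_operator_topology A L G" "limitin weak_operator_topology A M G"
    and "G \<noteq> bot"
  shows "L = M"
proof (rule blinfun_eqI, rule cinner_right_eqI)
  fix x y
  show "cinner y (L x) = cinner y (M x)"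
    using assms tendsto_unique unfolding limitin_weak_operator_topology by blast
qed

lemma limitin_weak_operator_topology_add_const:
  assumes "limitin weak_operator_topology A L G"
  shows "limitin weak_operator_topology (\<lambda>n. C + A n) (C + L) G"
  using assms unfolding limitin_weak_operator_topology
  by (simp add: plus_blinfun.rep_eq cinner_add_right tendsto_add)

lemma disjoint_family_shift:
  fixes D :: "nat \<Rightarrow> 'a set"
  shows "disjoint_family D \<Longrightarrow> disjoint_family (\<lambda>i. D (i + n))"
  by (auto simp: disjoint_family_on_def)

text \<open>Both sides are weak limits of the same sequence of partial sums, started at index \<open>n\<close>:
  the left side by additivity on the whole family, the right side by additivity on the shifted
  family, with the first \<open>n\<close> terms carried along as a constant. Weak limits are unique.\<close>

lemma povm_split_tail:
  fixes F :: "'x::topological_space set \<Rightarrow> ('h::complex_hilbert_space \<Rightarrow>\<^sub>L 'h)"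
    and D :: "nat \<Rightarrow> 'x set"
  assumes "povm F" "range D \<subseteq> sets borel" "disjoint_family D"
  shows "F (\<Union>i. D i) = (\<Sum>i<n. F (D i)) + F (\<Union>i. D (i + n))"
proof (rule limitin_weak_operator_topology_unique)
  have additive: "limitin weak_operator_topology (\<lambda>m. \<Sum>i<m. F (E i)) (F (\<Union>i. E i)) sequentially"
    if "range E \<subseteq> sets borel" "disjoint_family E" for E :: "nat \<Rightarrow> 'x set"
    using \<open>povm F\<close> that unfolding povm_def by blast
  show "limitin weak_operator_topology (\<lambda>m. \<Sum>i<m + n. F (D i)) (F (\<Union>i. D i)) sequentially"
    using additive[OF assms(2,3)] unfolding limitin_weak_operator_topology
    by (intro allI LIMSEQ_ignore_initial_segment) blast
  have split: "(\<Sum>i<m + n. F (D i)) = (\<Sum>i<n. F (D i)) + (\<Sum>i<m. F (D (i + n)))" for m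
    by (induction m) (simp_all add: algebra_simps)
  have "limitin weak_operator_topology (\<lambda>m. \<Sum>i<m. F (D (i + n))) (F (\<Union>i. D (i + n))) sequentially"
    using assms(2) by (intro additive disjoint_family_shift assms(3)) auto
  then show "limitin weak_operator_topology (\<lambda>m. \<Sum>i<m + n. F (D i))
      ((\<Sum>i<n. F (D i)) + F (\<Union>i. D (i + n))) sequentially"
    unfolding split by (rule limitin_weak_operator_topology_add_const)
qed simp

text \<open>A point of \<open>D i\<close> lies in no other piece, hence leaves the remainders after step \<open>i\<close>;
  so their intersection is empty and continuity from above applies.\<close>

lemma finite_measure_tail_tendsto_0:
  fixes D :: "nat \<Rightarrow> 'a set"
  assumes "finite_measure M" "range D \<subseteq> sets M" "disjoint_family D"
  shows "(\<lambda>n. measure M (\<Union>i. D (i + n))) \<longlonglongrightarrow> 0"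
proof -
  interpret finite_measure M by fact
  let ?T = "\<lambda>n. \<Union>i. D (i + n)"
  have tail: "?T n = (\<Union>j\<in>{n..}. D j)" for n
  proof -
    have "(\<Union>i. D (i + n)) = (\<Union>i. D (n + i))"
      by (simp add: add.commute)
    also have "\<dots> = \<Union> (D ` plus n ` {0..})"
      by (simp only: image_image atLeast_0)
    finally show ?thesis
      by (simp only: image_add_atLeast add_0_right)
  qed
  have "(\<Inter>n. ?T n) = {}"
  proof (rule ccontr)
    assume "(\<Inter>n. ?T n) \<noteq> {}"
    then obtain x where x: "\<And>n. x \<in> ?T n" by blast
    obtain i where "x \<in> D i" using x[of 0] by auto
    moreover obtain j where "j \<ge> Suc i" "x \<in> D j" using x[of "Suc i"] unfolding tail by auto
    ultimately show False
      using disjoint_family_onD[OF assms(3), of i j] by auto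
  qed
  moreover have "(\<lambda>n. measure M (?T n)) \<longlonglongrightarrow> measure M (\<Inter>n. ?T n)"
  proof (rule finite_Lim_measure_decseq)
    show "range ?T \<subseteq> sets M" using assms(2) by auto
    show "decseq ?T" unfolding tail decseq_def by (intro allI impI UN_mono) simp_all
  qed
  ultimately show ?thesis by simp
qed

lemma norm_bounded_by_real:
  assumes "norm_bounded_by F \<nu>" "finite_measure \<nu>"
  obtains c where "\<And>\<Delta>. \<Delta> \<in> sets borel \<Longrightarrow> norm (F \<Delta>) \<le> c * measure \<nu> \<Delta>"
proof -
  interpret finite_measure \<nu> by fact
  obtain c where c: "c > 0"
      "\<And>\<Delta>. \<Delta> \<in> sets borel \<Longrightarrow> ennreal (norm (F \<Delta>)) \<le> ennreal c * emeasure \<nu> \<Delta>"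
    using assms(1) unfolding norm_bounded_by_def by blast
  have "norm (F \<Delta>) \<le> c * measure \<nu> \<Delta>" if "\<Delta> \<in> sets borel" for \<Delta>
    using c(2)[OF that] c(1) by (simp add: emeasure_eq_measure flip: ennreal_mult)
  then show thesis by (rule that)
qed

theorem theorem6p2:
  fixes F :: "'x::{t2_space, second_countable_topology} set \<Rightarrow> ('h::complex_hilbert_space \<Rightarrow>\<^sub>L 'h)"
    and \<nu> :: "'x measure"
  assumes "locally_compact_space (euclidean :: 'x topology)"
    and "povm F"
    and "sets \<nu> = sets borel"
    and "finite_measure \<nu>"
    and "norm_bounded_by F \<nu>"
  shows "uniformly_continuous_povm F"
  unfolding uniformly_continuous_povm_def
proof (intro ballI allI impI)
  fix \<Delta> and D :: "nat \<Rightarrow> 'x set"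
  assume D: "range D \<subseteq> sets borel" "disjoint_family D" and \<Delta>: "\<Delta> = (\<Union>i. D i)"
  obtain c where c: "\<And>\<Delta>. \<Delta> \<in> sets borel \<Longrightarrow> norm (F \<Delta>) \<le> c * measure \<nu> \<Delta>"
    using norm_bounded_by_real assms(4,5) by blast
  have bound: "norm ((\<Sum>i<n. F (D i)) - F \<Delta>) \<le> c * measure \<nu> (\<Union>i. D (i + n))" for n
  proof -
    have "(\<Sum>i<n. F (D i)) - F \<Delta> = - F (\<Union>i. D (i + n))"
      unfolding \<Delta> povm_split_tail[OF assms(2) D, of n] by simp
    moreover have "(\<Union>i. D (i + n)) \<in> sets borel" using D(1) by auto
    ultimately show ?thesis using c by simp
  qed
  have "(\<lambda>n. c * measure \<nu> (\<Union>i. D (i + n))) \<longlonglongrightarrow> 0"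
    using finite_measure_tail_tendsto_0[OF assms(4)] D assms(3)
    by (intro tendsto_mult_right_zero) simp
  then have "(\<lambda>n. (\<Sum>i<n. F (D i)) - F \<Delta>) \<longlonglongrightarrow> 0"
    by (rule Lim_null_comparison[OF always_eventually[OF allI[OF bound]]])
  then show "(\<lambda>n. \<Sum>i<n. F (D i)) \<longlonglongrightarrow> F \<Delta>"
    by (rule LIM_zero_cancel)
qed

end
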